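(* (Deduction Theorem, second version.) Let $\Phi$ be a set of statements in the mathematical system $[M;\mathcal L]$ with restricted argument lists (so that $[M(\Phi);\mathcal L]$ is a mathematical system with restricted argument lists). For every formula $F$ in $[M;\mathcal L]$: $F\in\Pi(M(\Phi);\mathcal L)$ if and only if there are finitely many statements $\varphi_1,\dots,\varphi_m\in\Phi$ with $\to\varphi_1\dots\to\varphi_m\,F\in\Pi(M;\mathcal L)$.
   Context: Formulas are in Polish notation. Symbols (pairwise disjoint): a set $A_M$ of constant/operation symbols, a set $P_M$ of predicate symbols, a countably infinite set $X$ of variables, and $\sim,(,),\,,\,,\to,\neg,\leftrightarrow,\&,\vee,\forall,\exists$. Lists: $a\in A_M$, $x\in X$, $f(\lambda)$, concatenations. Prime formulas $\sim\lambda,\mu$ and $p\,\lambda_1,\dots,\lambda_n$; formulas built with $\neg$, $J\in\{\to,\leftrightarrow,\&,\vee\}$, $\forall x$, $\exists x$. Argument lists: maximal lists not immediately following a quantifier. $\mathrm{SbF}(F;\mu;x)$ replaces free occurrences of $x$ by $\mu$; $\mathrm{CF}(F;\mu;x)$: true for prime $F$, passes through connectives, $\mathrm{CF}(QyF;\mu;x)$ iff $x\notin\mathrm{free}(F)\setminus\{y\}$ or ($y\notin\mathrm{var}(\mu)$ and $\mathrm{CF}(F;\mu;x)$). A recursive system $S=[A_S;P_S;B_S]$: finite $A_S\subseteq A_M$, $P_S\subseteq P_M$, finite list $B_S$ of R-formulas ($\to F_1\dots\to F_rG$, prime $F_j,G$; $G$ the R-conclusion). Mathematical system $M=[S;A_M;P_M;B_M]$,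 $B_M\supseteq B_S$. Axioms: tautology instances; equality axioms $\sim x,x$, $\to\mathrm{SbF}(\sim\lambda,\mu;x;y)\to\sim x,y\ \sim\lambda,\mu$, $\to\sim x_1,y_1\dots\to\sim x_n,y_n\to p\,x_1..x_n\ p\,y_1..y_n$; quantifier axioms $\to\forall xF\,F$, $\to\forall x\to FG\to F\forall xG$ ($x\notin\mathrm{free}(F)$), $\leftrightarrow\neg\forall x\neg F\ \exists xF$; $B_M$. Rules: axiom, modus ponens, substitution under CF, generalization, Induction (for $p\in P_S$, distinct $x_1..x_i$, $G$ with variables not in $B_S$: if for each $F\in B_S$ with $i$-ary $p$-conclusion the formula obtained by replacing each $i$-ary $p\,\lambda_1..\lambda_i$ by $G\frac{\lambda_1}{x_1}\cdots\frac{\lambda_i}{x_i}$ is a step, append $\to p\,x_1..x_i\,G$). Restricted argument lists: $\mathcal L\supseteq X$ closed under substitution of lists of $\mathcal L$ for variables, containing argument lists of the basis axioms; $[M;\mathcal L]$ restricts all formulas in proofs to argument lists in $\mathcal L$ and substituted lists to $\mathcal L$; $\Pi(M;\mathcal L)$ is the set of provable formulas. A statement is a formula without free variables; for a set $\Phi$ of statements, $M(\Phi)=[S;A_M;P_M;B_M\cup\Phi]$. *)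

theory Defs
  imports Main
begin

section \<open>Lists\<close>

text \<open>
  Expressions are represented by abstract syntax instead of strings in Polish notation; the
  separating symbols (brackets and comma) only serve unique readability. Variables are indexed by
  natural numbers. A list of the formal language is a non-empty HOL list of items, so that
  concatenation stays associative as it is for strings. \<open>Op f l\<close> is the item \<open>f(l)\<close>.
\<close>

datatype 'a item = Cst 'a | Var nat | Op 'a "'a item list"

type_synonym 'a lst = "'a item list"

inductive_set lists_over :: "'a set \<Rightarrow> 'a lst set" for A :: "'a set" where
  const: "a \<in> A \<Longrightarrow> [Cst a] \<in> lists_over A"
| var: "[Var x] \<in> lists_over A"
| oper: "f \<in> A \<Longrightarrow> l \<in> lists_over A \<Longrightarrow> [Op f l] \<in> lists_over A"
| cat: "l \<in> lists_over A \<Longrightarrow> m \<in> lists_over A \<Longrightarrow> l @ m \<in> lists_over A"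

primrec var_item :: "'a item \<Rightarrow> nat set" where
  "var_item (Cst a) = {}"
| "var_item (Var x) = {x}"
| "var_item (Op f l) = \<Union> (set (map var_item l))"

definition var_lst :: "'a lst \<Rightarrow> nat set" where
  "var_lst l = \<Union> (set (map var_item l))"

primrec sb_item :: "'a lst \<Rightarrow> nat \<Rightarrow> 'a item \<Rightarrow> 'a lst" where
  "sb_item m x (Cst a) = [Cst a]"
| "sb_item m x (Var y) = (if y = x then m else [Var y])"
| "sb_item m x (Op f l) = [Op f (concat (map (sb_item m x) l))]"

text \<open>\<open>sb_lst l m x\<close> replaces every occurrence of the variable \<open>x\<close> in \<open>l\<close> by the list \<open>m\<close>.\<close>

definition sb_lst :: "'a lst \<Rightarrow> 'a lst \<Rightarrow> nat \<Rightarrow> 'a lst" where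
  "sb_lst l m x = concat (map (sb_item m x) l)"

section \<open>Formulas\<close>

datatype conn = To | Iff | And | Or

datatype quant = Forall | Exists

datatype ('a, 'p) fm =
    Eq "'a lst" "'a lst"
  | Pred 'p "'a lst list"
  | Neg "('a, 'p) fm"
  | Bin conn "('a, 'p) fm" "('a, 'p) fm"
  | Qu quant nat "('a, 'p) fm"

abbreviation Imp :: "('a, 'p) fm \<Rightarrow> ('a, 'p) fm \<Rightarrow> ('a, 'p) fm" where
  "Imp \<equiv> Bin To"

text \<open>\<open>Imps [F1, \<dots>, Fr] G\<close> is \<open>\<rightarrow> F1 \<dots> \<rightarrow> Fr G\<close>.\<close>

definition Imps :: "('a, 'p) fm list \<Rightarrow> ('a, 'p) fm \<Rightarrow> ('a, 'p) fm" where
  "Imps Fs G = foldr Imp Fs G"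

text \<open>Predicate symbols have no fixed arity; arity 0 is allowed.\<close>

inductive_set prime_over :: "'a set \<Rightarrow> 'p set \<Rightarrow> ('a, 'p) fm set"
  for A :: "'a set" and P :: "'p set" where
  "l \<in> lists_over A \<Longrightarrow> m \<in> lists_over A \<Longrightarrow> Eq l m \<in> prime_over A P"
| "p \<in> P \<Longrightarrow> set ls \<subseteq> lists_over A \<Longrightarrow> Pred p ls \<in> prime_over A P"

inductive_set formulas_over :: "'a set \<Rightarrow> 'p set \<Rightarrow> ('a, 'p) fm set"
  for A :: "'a set" and P :: "'p set" where
  "F \<in> prime_over A P \<Longrightarrow> F \<in> formulas_over A P"
| "F \<in> formulas_over A P \<Longrightarrow> Neg F \<in> formulas_over A P"
| "F \<in> formulas_over A P \<Longrightarrow> G \<in> formulas_over A P \<Longrightarrow> Bin J F G \<in> formulas_over A P"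
| "F \<in> formulas_over A P \<Longrightarrow> Qu Q x F \<in> formulas_over A P"

primrec arg_lists :: "('a, 'p) fm \<Rightarrow> 'a lst set" where
  "arg_lists (Eq l m) = {l, m}"
| "arg_lists (Pred p ls) = set ls"
| "arg_lists (Neg F) = arg_lists F"
| "arg_lists (Bin J F G) = arg_lists F \<union> arg_lists G"
| "arg_lists (Qu Q x F) = arg_lists F"

text \<open>All variables of a formula, including those that only follow a quantifier.\<close>

primrec var_fm :: "('a, 'p) fm \<Rightarrow> nat set" where
  "var_fm (Eq l m) = var_lst l \<union> var_lst m"
| "var_fm (Pred p ls) = \<Union> (var_lst ` set ls)"
| "var_fm (Neg F) = var_fm F"
| "var_fm (Bin J F G) = var_fm F \<union> var_fm G"
| "var_fm (Qu Q x F) = insert x (var_fm F)"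

primrec free :: "('a, 'p) fm \<Rightarrow> nat set" where
  "free (Eq l m) = var_lst l \<union> var_lst m"
| "free (Pred p ls) = \<Union> (var_lst ` set ls)"
| "free (Neg F) = free F"
| "free (Bin J F G) = free F \<union> free G"
| "free (Qu Q x F) = free F - {x}"

primrec SbF :: "('a, 'p) fm \<Rightarrow> 'a lst \<Rightarrow> nat \<Rightarrow> ('a, 'p) fm" where
  "SbF (Eq l k) m x = Eq (sb_lst l m x) (sb_lst k m x)"
| "SbF (Pred p ls) m x = Pred p (map (\<lambda>l. sb_lst l m x) ls)"
| "SbF (Neg F) m x = Neg (SbF F m x)"
| "SbF (Bin J F G) m x = Bin J (SbF F m x) (SbF G m x)"
| "SbF (Qu Q y F) m x = (if y = x then Qu Q y F else Qu Q y (SbF F m x))"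

primrec CF :: "('a, 'p) fm \<Rightarrow> 'a lst \<Rightarrow> nat \<Rightarrow> bool" where
  "CF (Eq l k) m x \<longleftrightarrow> True"
| "CF (Pred p ls) m x \<longleftrightarrow> True"
| "CF (Neg F) m x \<longleftrightarrow> CF F m x"
| "CF (Bin J F G) m x \<longleftrightarrow> CF F m x \<and> CF G m x"
| "CF (Qu Q y F) m x \<longleftrightarrow> x \<notin> free F - {y} \<or> (y \<notin> var_lst m \<and> CF F m x)"

section \<open>Recursive and mathematical systems\<close>

inductive_set R_formulas :: "'a set \<Rightarrow> 'p set \<Rightarrow> ('a, 'p) fm set"
  for A :: "'a set" and P :: "'p set" where
  "set Fs \<subseteq> prime_over A P \<Longrightarrow> G \<in> prime_over A P \<Longrightarrow> Imps Fs G \<in> R_formulas A P"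

text \<open>\<open>R_concl F G\<close>: the prime formula \<open>G\<close> is the R-conclusion of the R-formula \<open>F\<close>.\<close>

definition R_concl :: "('a, 'p) fm \<Rightarrow> ('a, 'p) fm \<Rightarrow> bool" where
  "R_concl F G \<longleftrightarrow>
     (\<exists>Fs. set Fs \<subseteq> prime_over UNIV UNIV \<and> G \<in> prime_over UNIV UNIV \<and> F = Imps Fs G)"

record ('a, 'p) rec_sys =
  AS :: "'a set"
  PS :: "'p set"
  BS :: "('a, 'p) fm list"

record ('a, 'p) math_sys =
  RS :: "('a, 'p) rec_sys"
  AM :: "'a set"
  PM :: "'p set"
  BM :: "('a, 'p) fm set"

definition recursive_system :: "('a, 'p) rec_sys \<Rightarrow> bool" where
  "recursive_system S \<longleftrightarrow>
     finite (AS S) \<and> finite (PS S) \<and> set (BS S) \<subseteq> R_formulas (AS S) (PS S)"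

definition mathematical_system :: "('a, 'p) math_sys \<Rightarrow> bool" where
  "mathematical_system M \<longleftrightarrow>
     recursive_system (RS M) \<and> AS (RS M) \<subseteq> AM M \<and> PS (RS M) \<subseteq> PM M \<and>
     BM M \<subseteq> formulas_over (AM M) (PM M) \<and> set (BS (RS M)) \<subseteq> BM M"

text \<open>\<open>restricted_system M L\<close>: \<open>[M; L]\<close> is a mathematical system with restricted argument lists.\<close>

definition restricted_system :: "('a, 'p) math_sys \<Rightarrow> 'a lst set \<Rightarrow> bool" where
  "restricted_system M L \<longleftrightarrow>
     mathematical_system M \<and> L \<subseteq> lists_over (AM M) \<and>
     (\<forall>x. [Var x] \<in> L) \<and>
     (\<forall>l\<in>L. \<forall>m\<in>L. \<forall>x. sb_lst l m x \<in> L) \<and>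
     (\<forall>F\<in>BM M. arg_lists F \<subseteq> L)"

definition formulas :: "('a, 'p) math_sys \<Rightarrow> 'a lst set \<Rightarrow> ('a, 'p) fm set" where
  "formulas M L = {F \<in> formulas_over (AM M) (PM M). arg_lists F \<subseteq> L}"

definition statements :: "('a, 'p) math_sys \<Rightarrow> 'a lst set \<Rightarrow> ('a, 'p) fm set" where
  "statements M L = {F \<in> formulas M L. free F = {}}"

text \<open>The system \<open>M(\<Phi>)\<close>.\<close>

definition adjoin :: "('a, 'p) math_sys \<Rightarrow> ('a, 'p) fm set \<Rightarrow> ('a, 'p) math_sys" where
  "adjoin M \<Phi> = M\<lparr>BM := BM M \<union> \<Phi>\<rparr>"

lemma restricted_system_adjoin:
  assumes "restricted_system M L" and "\<Phi> \<subseteq> statements M L"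
  shows "restricted_system (adjoin M \<Phi>) L"
  using assms
  unfolding restricted_system_def mathematical_system_def adjoin_def statements_def formulas_def
  by auto

section \<open>Axioms\<close>

datatype pform = PVar nat | PNeg pform | PBin conn pform pform

primrec conn_val :: "conn \<Rightarrow> bool \<Rightarrow> bool \<Rightarrow> bool" where
  "conn_val To a b = (a \<longrightarrow> b)"
| "conn_val Iff a b = (a \<longleftrightarrow> b)"
| "conn_val And a b = (a \<and> b)"
| "conn_val Or a b = (a \<or> b)"

primrec pval :: "(nat \<Rightarrow> bool) \<Rightarrow> pform \<Rightarrow> bool" where
  "pval v (PVar n) = v n"
| "pval v (PNeg a) = (\<not> pval v a)"
| "pval v (PBin J a b) = conn_val J (pval v a) (pval v b)"

primrec pinst :: "(nat \<Rightarrow> ('a, 'p) fm) \<Rightarrow> pform \<Rightarrow> ('a, 'p) fm" where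
  "pinst s (PVar n) = s n"
| "pinst s (PNeg a) = Neg (pinst s a)"
| "pinst s (PBin J a b) = Bin J (pinst s a) (pinst s b)"

definition tautology :: "pform \<Rightarrow> bool" where
  "tautology a \<longleftrightarrow> (\<forall>v. pval v a)"

text \<open>
  Axiom schemes, still without reference to the symbols of a system; in \<open>is_proof\<close> below only
  instances that are formulas of \<open>[M; L]\<close> are admitted.
\<close>

inductive logical_axiom :: "('a, 'p) fm \<Rightarrow> bool" where
  taut: "tautology a \<Longrightarrow> logical_axiom (pinst s a)"
| eq_refl: "logical_axiom (Eq [Var x] [Var x])"
| eq_subst: "logical_axiom (Imp (SbF (Eq l m) [Var x] y) (Imp (Eq [Var x] [Var y]) (Eq l m)))"
| eq_pred: "length xs = length ys \<Longrightarrow>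
    logical_axiom
      (Imps (map2 (\<lambda>x y. Eq [Var x] [Var y]) xs ys)
        (Imp (Pred p (map (\<lambda>x. [Var x]) xs)) (Pred p (map (\<lambda>y. [Var y]) ys))))"
| all_elim: "logical_axiom (Imp (Qu Forall x F) F)"
| all_imp: "x \<notin> free F \<Longrightarrow>
    logical_axiom (Imp (Qu Forall x (Imp F G)) (Imp F (Qu Forall x G)))"
| ex_def: "logical_axiom (Bin Iff (Neg (Qu Forall x (Neg F))) (Qu Exists x F))"

section \<open>Proofs\<close>

definition SbFs :: "('a, 'p) fm \<Rightarrow> 'a lst list \<Rightarrow> nat list \<Rightarrow> ('a, 'p) fm" where
  "SbFs G ls xs = foldl (\<lambda>H (l, x). SbF H l x) G (zip ls xs)"

text \<open>
  \<open>repl p xs G F\<close> replaces in \<open>F\<close> each subformula \<open>p l1,\<dots>,li\<close> of arity \<open>i = length xs\<close> by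
  \<open>G(l1/x1)\<dots>(li/xi)\<close>. In the induction rule the variables \<open>xs\<close> do not occur in the lists \<open>l1,\<dots>,li\<close>,
  hence successive and simultaneous substitution agree.
\<close>

primrec repl :: "'p \<Rightarrow> nat list \<Rightarrow> ('a, 'p) fm \<Rightarrow> ('a, 'p) fm \<Rightarrow> ('a, 'p) fm" where
  "repl p xs G (Eq l m) = Eq l m"
| "repl p xs G (Pred q ls) =
     (if q = p \<and> length ls = length xs then SbFs G ls xs else Pred q ls)"
| "repl p xs G (Neg F) = Neg (repl p xs G F)"
| "repl p xs G (Bin J F H) = Bin J (repl p xs G F) (repl p xs G H)"
| "repl p xs G (Qu Q y F) = Qu Q y (repl p xs G F)"

definition var_BS :: "('a, 'p) rec_sys \<Rightarrow> nat set" where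
  "var_BS S = \<Union> (var_fm ` set (BS S))"

inductive is_proof :: "('a, 'p) math_sys \<Rightarrow> 'a lst set \<Rightarrow> ('a, 'p) fm list \<Rightarrow> bool"
  for M :: "('a, 'p) math_sys" and L :: "'a lst set" where
  empty: "is_proof M L []"
| axiom: "is_proof M L \<Lambda> \<Longrightarrow> logical_axiom F \<or> F \<in> BM M \<Longrightarrow> F \<in> formulas M L \<Longrightarrow>
    is_proof M L (\<Lambda> @ [F])"
| mp: "is_proof M L \<Lambda> \<Longrightarrow> F \<in> set \<Lambda> \<Longrightarrow> Imp F G \<in> set \<Lambda> \<Longrightarrow> is_proof M L (\<Lambda> @ [G])"
| subst: "is_proof M L \<Lambda> \<Longrightarrow> F \<in> set \<Lambda> \<Longrightarrow> l \<in> L \<Longrightarrow> CF F l x \<Longrightarrow>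
    is_proof M L (\<Lambda> @ [SbF F l x])"
| gen: "is_proof M L \<Lambda> \<Longrightarrow> F \<in> set \<Lambda> \<Longrightarrow> is_proof M L (\<Lambda> @ [Qu Forall x F])"
| induction: "is_proof M L \<Lambda> \<Longrightarrow> p \<in> PS (RS M) \<Longrightarrow> distinct xs \<Longrightarrow> G \<in> formulas M L \<Longrightarrow>
    set xs \<inter> var_BS (RS M) = {} \<Longrightarrow> var_fm G \<inter> var_BS (RS M) = {} \<Longrightarrow>
    (\<And>F ls. F \<in> set (BS (RS M)) \<Longrightarrow> R_concl F (Pred p ls) \<Longrightarrow> length ls = length xs \<Longrightarrow>
       repl p xs G F \<in> set \<Lambda>) \<Longrightarrow>
    is_proof M L (\<Lambda> @ [Imp (Pred p (map (\<lambda>x. [Var x]) xs)) G])"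

definition provable :: "('a, 'p) math_sys \<Rightarrow> 'a lst set \<Rightarrow> ('a, 'p) fm set" ("\<Pi>") where
  "\<Pi> M L = {F. \<exists>\<Lambda>. is_proof M L \<Lambda> \<and> F \<in> set \<Lambda>}"

end

(*
  Every step of a proof in M(\<Phi>) is shown to be derivable in M from finitely many premises in \<Phi>.
  Tautologies and the quantifier axiom for implications settle all rules but induction, because
  substitution does not affect premises without free variables.

  For the induction rule with formula G and premises \<phi>s, apply induction in M to the implication from
  \<phi>s to G.  The rule forbids this formula to contain variables of the basis axioms, even bound ones,
  so first the bound variables of \<phi>s are renamed; this needs the equivalence of alphabetic
  variants in M.
*)

theory Submission
  imports Defs
begin

section \<open>Substitution and variables\<close>

lemma var_lst_simps [simp]:
  "var_lst [] = {}" "var_lst (i # l) = var_item i \<union> var_lst l"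
  "var_lst (l @ m) = var_lst l \<union> var_lst m"
  by (auto simp: var_lst_def)

lemma sb_lst_simps [simp]:
  "sb_lst [] m x = []" "sb_lst (i # l) m x = sb_item m x i @ sb_lst l m x"
  "sb_lst (l @ k) m x = sb_lst l m x @ sb_lst k m x"
  by (auto simp: sb_lst_def)

text \<open>Together with \<open>sb_item_Op\<close>, this folds the recursion through
  \<open>map\<close> back into the list functions, so that the \<open>Op\<close> case matches an
  induction hypothesis about lists.\<close>

lemma var_item_Op [simp]: "var_item (Op f l) = var_lst l"
  by (simp add: var_lst_def)

lemma sb_item_Op [simp]: "sb_item m x (Op f l) = [Op f (sb_lst l m x)]"
  by (simp add: sb_lst_def)

declare var_item.simps(3) [simp del] sb_item.simps(3) [simp del]

text \<open>The datatype is nested through lists. Giving lists a predicate of their own allows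
  claims about items and lists to be proved simultaneously.\<close>

lemma item_lst_induct [case_names Cst Var Op Nil Cons]:
  assumes "\<And>a. P (Cst a)" "\<And>x. P (Var x)" "\<And>f l. Q l \<Longrightarrow> P (Op f l)"
    and "Q []" "\<And>i l. P i \<Longrightarrow> Q l \<Longrightarrow> Q (i # l)"
  shows "P i" and "Q l"
proof -
  have *: "(\<And>i. i \<in> set l \<Longrightarrow> P i) \<Longrightarrow> Q l" for l
    by (induction l) (use assms(4,5) in auto)
  show P: "P i" for i
    by (induction i) (use assms(1-3) * in auto)
  show "Q l"
    using * P by blast
qed

lemma
  fixes i :: "'a item" and l :: "'a lst"
  shows sb_item_notin: "x \<notin> var_item i \<Longrightarrow> sb_item m x i = [i]"
    and sb_lst_notin: "x \<notin> var_lst l \<Longrightarrow> sb_lst l m x = l"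
  by (induction i and l rule: item_lst_induct) auto

lemma
  fixes i :: "'a item" and l :: "'a lst"
  shows var_sb_item: "var_lst (sb_item m x i) \<subseteq> (var_item i - {x}) \<union> var_lst m"
    and var_sb_lst: "var_lst (sb_lst l m x) \<subseteq> (var_lst l - {x}) \<union> var_lst m"
  by (induction i and l rule: item_lst_induct) auto

text \<open>Freshness of \<open>z\<close> ensures that only the occurrences created by the first
  substitution are turned back into \<open>y\<close>.\<close>

lemma
  fixes i :: "'a item" and l :: "'a lst"
  shows sb_item_back: "z \<notin> var_item i \<Longrightarrow> sb_lst (sb_item [Var z] y i) [Var y] z = [i]"
    and sb_lst_back: "z \<notin> var_lst l \<Longrightarrow> sb_lst (sb_lst l [Var z] y) [Var y] z = l"
  by (induction i and l rule: item_lst_induct) auto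

section \<open>Free and bound variables under substitution\<close>

primrec bound :: "('a, 'p) fm \<Rightarrow> nat set" where
  "bound (Eq l m) = {}"
| "bound (Pred p ls) = {}"
| "bound (Neg F) = bound F"
| "bound (Bin J F G) = bound F \<union> bound G"
| "bound (Qu Q x F) = insert x (bound F)"

lemma var_fm_eq: "var_fm F = free F \<union> bound F"
  by (induction F) auto

lemma finite_var_lst: "finite (var_lst l)"
  by (rule item_lst_induct(2)[where P = "\<lambda>i. finite (var_item i)"]) auto

lemma finite_var_fm: "finite (var_fm F)"
  by (induction F) (auto simp: finite_var_lst)

lemma SbF_notin: "x \<notin> free F \<Longrightarrow> SbF F m x = F"
  by (induction F) (auto simp: sb_lst_notin intro: map_idI)

lemma CF_notin: "x \<notin> free F \<Longrightarrow> CF F m x"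
  by (induction F) auto

text \<open>Capture requires a quantifier that binds a variable of the inserted list.\<close>

lemma CF_bound: "bound F \<inter> var_lst m = {} \<Longrightarrow> CF F m x"
  by (induction F) auto

lemma bound_SbF [simp]: "bound (SbF F m x) = bound F"
  by (induction F) auto

lemma free_SbF: "free (SbF F m x) \<subseteq> (free F - {x}) \<union> var_lst m"
proof (induction F)
  case (Eq l k)
  then show ?case using var_sb_lst[of l m x] var_sb_lst[of k m x] by auto
next
  case (Pred p ls)
  then show ?case using var_sb_lst[of _ m x] by fastforce
qed auto

text \<open>Besides not being free, \<open>z\<close> must not be bound, since a quantifier on
  \<open>z\<close> would block the substitution back.\<close>

lemma SbF_back: "z \<notin> var_fm F \<Longrightarrow> SbF (SbF F [Var z] y) [Var y] z = F"
proof (induction F)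
  case (Qu Q x F)
  \<comment> \<open>Used when the quantifier binds \<open>y\<close>: the first substitution then
    changes nothing, and the second finds no free \<open>z\<close>.\<close>
  then have "z \<notin> free F" by (auto simp: var_fm_eq)
  with Qu show ?case by (auto simp: SbF_notin)
qed (auto simp: sb_lst_back intro: map_idI)

section \<open>Iterated implications\<close>

lemma Imps_simps [simp]:
  "Imps [] G = G" "Imps (F # Fs) G = Imp F (Imps Fs G)"
  by (auto simp: Imps_def)

lemma var_fm_Imps: "var_fm (Imps Fs G) = \<Union> (var_fm ` set Fs) \<union> var_fm G"
  by (induction Fs) auto

lemma CF_Imps: "CF (Imps Fs G) m x \<longleftrightarrow> (\<forall>F\<in>set Fs. CF F m x) \<and> CF G m x"
  by (induction Fs) auto

text \<open>Closed formulas are fixed by every substitution; this is what the premises gain from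
  being statements.\<close>

lemma SbF_Imps_closed:
  "\<forall>F\<in>set Fs. free F = {} \<Longrightarrow> SbF (Imps Fs G) m x = Imps Fs (SbF G m x)"
  by (induction Fs) (auto simp: SbF_notin)

lemma SbFs_simps [simp]:
  "SbFs G [] xs = G" "SbFs G ls [] = G" "SbFs G (l # ls) (x # xs) = SbFs (SbF G l x) ls xs"
  by (auto simp: SbFs_def)

lemma SbFs_Imps_closed:
  "\<forall>F\<in>set Fs. free F = {} \<Longrightarrow> SbFs (Imps Fs G) ls xs = Imps Fs (SbFs G ls xs)"
proof (induction ls arbitrary: G xs)
  case (Cons l ls)
  then show ?case by (cases xs) (auto simp: SbF_Imps_closed)
qed simp

section \<open>Propositional reasoning\<close>

text \<open>Prime formulas and quantified formulas serve as propositional atoms.\<close>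

primrec fmval :: "(('a, 'p) fm \<Rightarrow> bool) \<Rightarrow> ('a, 'p) fm \<Rightarrow> bool" where
  "fmval v (Eq l m) = v (Eq l m)"
| "fmval v (Pred p ls) = v (Pred p ls)"
| "fmval v (Neg F) = (\<not> fmval v F)"
| "fmval v (Bin J F G) = conn_val J (fmval v F) (fmval v G)"
| "fmval v (Qu Q x F) = v (Qu Q x F)"

primrec atoms :: "('a, 'p) fm \<Rightarrow> ('a, 'p) fm set" where
  "atoms (Eq l m) = {Eq l m}"
| "atoms (Pred p ls) = {Pred p ls}"
| "atoms (Neg F) = atoms F"
| "atoms (Bin J F G) = atoms F \<union> atoms G"
| "atoms (Qu Q x F) = {Qu Q x F}"

text \<open>The numbering \<open>f\<close> is a parameter: propositional variables are natural
  numbers, whereas formulas over arbitrary symbol types may be uncountable.\<close>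

primrec abstract :: "(('a, 'p) fm \<Rightarrow> nat) \<Rightarrow> ('a, 'p) fm \<Rightarrow> pform" where
  "abstract f (Eq l m) = PVar (f (Eq l m))"
| "abstract f (Pred p ls) = PVar (f (Pred p ls))"
| "abstract f (Neg F) = PNeg (abstract f F)"
| "abstract f (Bin J F G) = PBin J (abstract f F) (abstract f G)"
| "abstract f (Qu Q x F) = PVar (f (Qu Q x F))"

lemma finite_atoms: "finite (atoms F)"
  by (induction F) auto

lemma pinst_abstract: "\<forall>A\<in>atoms F. s (f A) = A \<Longrightarrow> pinst s (abstract f F) = F"
  by (induction F) auto

lemma pval_abstract: "pval v (abstract f F) = fmval (v \<circ> f) F"
  by (induction F) auto

text \<open>A single formula has finitely many atoms, so some numbering is injective on them.
  Abstracting along it yields a tautology, and \<open>F\<close> is its instance under the inverse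
  numbering.\<close>

lemma logical_axiom_valid:
  assumes "\<And>v. fmval v F"
  shows "logical_axiom F"
proof -
  obtain f :: "('a, 'b) fm \<Rightarrow> nat" where "inj_on f (atoms F)"
    using finite_imp_inj_to_nat_seg[OF finite_atoms] by blast
  then have "pinst (inv_into (atoms F) f) (abstract f F) = F"
    by (simp add: pinst_abstract)
  moreover have "tautology (abstract f F)"
    using assms by (simp add: tautology_def pval_abstract)
  ultimately show ?thesis
    by (metis taut)
qed

lemma fmval_Imps: "fmval v (Imps Fs G) \<longleftrightarrow> ((\<forall>F\<in>set Fs. fmval v F) \<longrightarrow> fmval v G)"
  by (induction Fs) auto

text \<open>When all of \<open>Fs\<close> are true, \<open>Imps Fs G\<close> and \<open>G\<close>
  have the same truth value, also after substitution because \<open>Fs\<close> are closed. The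
  argument does not reach below quantifiers, as \<open>fmval\<close> takes quantified formulas as
  atoms; R-formulas are built from prime formulas by implication only.\<close>

lemma repl_prime:
  assumes "\<forall>F\<in>set Fs. free F = {}" and "\<forall>F\<in>set Fs. fmval v F" and "H \<in> prime_over A P"
  shows "fmval v (repl p xs (Imps Fs G) H) \<longleftrightarrow> fmval v (repl p xs G H)"
  using assms(3) by cases (use assms(1,2) in \<open>auto simp: SbFs_Imps_closed fmval_Imps\<close>)

lemma repl_Imps: "repl p xs G (Imps Fs H) = Imps (map (repl p xs G) Fs) (repl p xs G H)"
  by (induction Fs) auto

section \<open>Provable formulas\<close>

text \<open>Rules refer to earlier steps only through membership, so a longer prefix keeps them
  applicable.\<close>

lemma is_proof_append:
  assumes "is_proof M L \<Lambda>'" and "is_proof M L \<Lambda>"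
  shows "is_proof M L (\<Lambda> @ \<Lambda>')"
  using assms
proof (induction)
  case (axiom \<Lambda>' F)
  then show ?case using is_proof.axiom[of M L "\<Lambda> @ \<Lambda>'" F] by simp
next
  case (mp \<Lambda>' F G)
  then show ?case using is_proof.mp[of M L "\<Lambda> @ \<Lambda>'" F G] by simp
next
  case (subst \<Lambda>' F l x)
  then show ?case using is_proof.subst[of M L "\<Lambda> @ \<Lambda>'" F l x] by simp
next
  case (gen \<Lambda>' F x)
  then show ?case using is_proof.gen[of M L "\<Lambda> @ \<Lambda>'" F x] by simp
next
  case (induction \<Lambda>' p xs G)
  then show ?case using is_proof.induction[of M L "\<Lambda> @ \<Lambda>'" p xs G] by simp
qed simp

text \<open>The rules \<open>mp\<close> and \<open>induction\<close> want all their premises in one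
  proof; concatenation supplies it.\<close>

lemma finite_provable:
  assumes "finite X" and "X \<subseteq> \<Pi> M L"
  shows "\<exists>\<Lambda>. is_proof M L \<Lambda> \<and> X \<subseteq> set \<Lambda>"
  using assms
proof (induction X)
  case empty
  then show ?case using is_proof.empty by blast
next
  case (insert F X)
  then obtain \<Lambda> \<Lambda>' where "is_proof M L \<Lambda>" "X \<subseteq> set \<Lambda>" "is_proof M L \<Lambda>'" "F \<in> set \<Lambda>'"
    by (auto simp: provable_def)
  then have "is_proof M L (\<Lambda> @ \<Lambda>')" "insert F X \<subseteq> set (\<Lambda> @ \<Lambda>')"
    by (auto intro: is_proof_append)
  then show ?case by blast
qed

lemma provableI: "is_proof M L (\<Lambda> @ [F]) \<Longrightarrow> F \<in> \<Pi> M L"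
  unfolding provable_def by force

lemma provable_axiom:
  "logical_axiom F \<or> F \<in> BM M \<Longrightarrow> F \<in> formulas M L \<Longrightarrow> F \<in> \<Pi> M L"
  by (rule provableI[OF is_proof.axiom[OF is_proof.empty]])

lemma provable_mp:
  assumes "F \<in> \<Pi> M L" and "Imp F G \<in> \<Pi> M L"
  shows "G \<in> \<Pi> M L"
proof -
  obtain \<Lambda> where "is_proof M L \<Lambda>" "{F, Imp F G} \<subseteq> set \<Lambda>"
    using finite_provable[of "{F, Imp F G}"] assms by auto
  then show ?thesis by (auto intro: provableI is_proof.mp)
qed

lemma provable_subst: "F \<in> \<Pi> M L \<Longrightarrow> l \<in> L \<Longrightarrow> CF F l x \<Longrightarrow> SbF F l x \<in> \<Pi> M L"
  by (auto intro: provableI is_proof.subst simp: provable_def[of M L])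

lemma provable_gen: "F \<in> \<Pi> M L \<Longrightarrow> Qu Forall x F \<in> \<Pi> M L"
  by (auto intro: provableI is_proof.gen simp: provable_def[of M L])

lemma provable_induction:
  assumes "p \<in> PS (RS M)" "distinct xs" "G \<in> formulas M L"
    "set xs \<inter> var_BS (RS M) = {}" "var_fm G \<inter> var_BS (RS M) = {}"
    and basis: "\<And>F ls. F \<in> set (BS (RS M)) \<Longrightarrow> R_concl F (Pred p ls) \<Longrightarrow>
      length ls = length xs \<Longrightarrow> repl p xs G F \<in> \<Pi> M L"
  shows "Imp (Pred p (map (\<lambda>x. [Var x]) xs)) G \<in> \<Pi> M L"
proof -
  \<comment> \<open>This set is finite because the basis of a recursive system is a list.\<close>
  let ?X = "repl p xs G ` {F \<in> set (BS (RS M)). \<exists>ls. R_concl F (Pred p ls) \<and> length ls = length xs}"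
  have "?X \<subseteq> \<Pi> M L"
    using basis by auto
  then obtain \<Lambda> where "is_proof M L \<Lambda>" "?X \<subseteq> set \<Lambda>"
    using finite_provable[of ?X M L] by auto
  then show ?thesis
    by (intro provableI[OF is_proof.induction]) (use assms in auto)
qed

section \<open>The system with adjoined statements\<close>

lemma formulas_adjoin [simp]: "formulas (adjoin M \<Phi>) L = formulas M L"
  by (simp add: formulas_def adjoin_def)

lemma RS_adjoin [simp]: "RS (adjoin M \<Phi>) = RS M"
  by (simp add: adjoin_def)

lemma BM_adjoin [simp]: "BM (adjoin M \<Phi>) = BM M \<union> \<Phi>"
  by (simp add: adjoin_def)

text \<open>Only \<open>BM\<close> grows. The induction rule looks at \<open>RS\<close>, so its
  premises and variable conditions stay the same.\<close>

lemma is_proof_adjoin: "is_proof M L \<Lambda> \<Longrightarrow> is_proof (adjoin M \<Phi>) L \<Lambda>"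
proof (induction rule: is_proof.induct)
  case (induction \<Lambda> p xs G)
  then show ?case by (intro is_proof.induction) auto
qed (auto intro: is_proof.intros)

lemma provable_adjoin: "F \<in> \<Pi> M L \<Longrightarrow> F \<in> \<Pi> (adjoin M \<Phi>) L"
  by (auto simp: provable_def intro: is_proof_adjoin)

lemma provable_Imps_mp: "Imps Fs G \<in> \<Pi> M L \<Longrightarrow> set Fs \<subseteq> \<Pi> M L \<Longrightarrow> G \<in> \<Pi> M L"
  by (induction Fs) (auto intro: provable_mp)

lemma formulas_over_simps:
  "Neg F \<in> formulas_over A P \<longleftrightarrow> F \<in> formulas_over A P"
  "Bin J F G \<in> formulas_over A P \<longleftrightarrow> F \<in> formulas_over A P \<and> G \<in> formulas_over A P"
  "Qu Q x F \<in> formulas_over A P \<longleftrightarrow> F \<in> formulas_over A P"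
  "Eq l m \<in> formulas_over A P \<longleftrightarrow> l \<in> lists_over A \<and> m \<in> lists_over A"
  "Pred p ls \<in> formulas_over A P \<longleftrightarrow> p \<in> P \<and> set ls \<subseteq> lists_over A"
  by (auto elim: formulas_over.cases prime_over.cases intro: formulas_over.intros prime_over.intros)

lemma formulas_Neg [simp]: "Neg F \<in> formulas M L \<longleftrightarrow> F \<in> formulas M L"
  and formulas_Bin [simp]: "Bin J F G \<in> formulas M L \<longleftrightarrow> F \<in> formulas M L \<and> G \<in> formulas M L"
  and formulas_Qu [simp]: "Qu Q x F \<in> formulas M L \<longleftrightarrow> F \<in> formulas M L"
  by (auto simp: formulas_def formulas_over_simps)

lemma formulas_Imps: "Imps Fs G \<in> formulas M L \<longleftrightarrow> set Fs \<subseteq> formulas M L \<and> G \<in> formulas M L"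
  by (induction Fs) auto

section \<open>Derivability from premises\<close>

context
  fixes M :: "('a, 'p) math_sys" and L :: "'a lst set"
  assumes restricted: "restricted_system M L"
begin

lemma Var_in_L: "[Var x] \<in> L"
  and sb_lst_in_L: "l \<in> L \<Longrightarrow> m \<in> L \<Longrightarrow> sb_lst l m x \<in> L"
  using restricted by (auto simp: restricted_system_def)

lemma formulas_Eq: "Eq l m \<in> formulas M L \<longleftrightarrow> l \<in> L \<and> m \<in> L"
  and formulas_Pred: "Pred p ls \<in> formulas M L \<longleftrightarrow> p \<in> PM M \<and> set ls \<subseteq> L"
  using restricted by (auto simp: restricted_system_def formulas_def formulas_over_simps)

lemma BM_formulas: "BM M \<subseteq> formulas M L"
  using restricted by (auto simp: restricted_system_def mathematical_system_def formulas_def)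

lemma BS_formulas: "set (BS (RS M)) \<subseteq> formulas M L"
  using restricted BM_formulas by (auto simp: restricted_system_def mathematical_system_def)

lemma finite_var_BS: "finite (var_BS (RS M))"
  by (auto simp: var_BS_def finite_var_fm)

lemma SbF_formulas: "F \<in> formulas M L \<Longrightarrow> m \<in> L \<Longrightarrow> SbF F m x \<in> formulas M L"
  by (induction F) (auto simp: formulas_Eq formulas_Pred sb_lst_in_L)

lemma SbFs_formulas: "F \<in> formulas M L \<Longrightarrow> set ls \<subseteq> L \<Longrightarrow> SbFs F ls xs \<in> formulas M L"
proof (induction ls arbitrary: F xs)
  case (Cons l ls)
  then show ?case by (cases xs) (auto simp: SbF_formulas)
qed simp

lemma repl_formulas: "F \<in> formulas M L \<Longrightarrow> G \<in> formulas M L \<Longrightarrow> repl p xs G F \<in> formulas M L"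
  by (induction F) (auto simp: formulas_Eq formulas_Pred SbFs_formulas)

lemma Pred_Var_formulas:
  "p \<in> PS (RS M) \<Longrightarrow> Pred p (map (\<lambda>x. [Var x]) xs) \<in> formulas M L"
  using restricted
  by (auto simp: formulas_Pred Var_in_L restricted_system_def mathematical_system_def)

lemma is_proof_formulas: "is_proof M L \<Lambda> \<Longrightarrow> set \<Lambda> \<subseteq> formulas M L"
proof (induction rule: is_proof.induct)
  case (mp \<Lambda> F G)
  then have "Imp F G \<in> formulas M L" by blast
  with mp show ?case by simp
qed (auto simp: SbF_formulas Pred_Var_formulas)

lemma provable_formulas: "F \<in> \<Pi> M L \<Longrightarrow> F \<in> formulas M L"
  using is_proof_formulas by (auto simp: provable_def)

text \<open>Replaces propositional derivations by truth-value arguments: \<open>Imps Fs G\<close> is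
  an instance of a tautology, and modus ponens removes \<open>Fs\<close>.\<close>

lemma provable_taut:
  assumes "set Fs \<subseteq> \<Pi> M L" and "G \<in> formulas M L"
    and "\<And>v. \<forall>F\<in>set Fs. fmval v F \<Longrightarrow> fmval v G"
  shows "G \<in> \<Pi> M L"
proof -
  have "Imps Fs G \<in> \<Pi> M L"
    using assms
    by (intro provable_axiom disjI1 logical_axiom_valid)
      (auto simp: fmval_Imps formulas_Imps provable_formulas)
  then show ?thesis
    using assms(1) by (rule provable_Imps_mp)
qed

lemma provable_all_elim: "F \<in> formulas M L \<Longrightarrow> Imp (Qu Forall x F) F \<in> \<Pi> M L"
  by (intro provable_axiom) (auto intro: all_elim)

lemma provable_gen_imp:
  assumes "Imp F G \<in> \<Pi> M L" and "x \<notin> free F"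
  shows "Imp F (Qu Forall x G) \<in> \<Pi> M L"
proof (rule provable_mp)
  show "Qu Forall x (Imp F G) \<in> \<Pi> M L"
    using assms(1) by (rule provable_gen)
  show "Imp (Qu Forall x (Imp F G)) (Imp F (Qu Forall x G)) \<in> \<Pi> M L"
    using provable_formulas[OF assms(1)] assms(2)
    by (intro provable_axiom) (auto intro: all_imp)
qed

lemma provable_imp_trans:
  assumes "Imp F G \<in> \<Pi> M L" and "Imp G H \<in> \<Pi> M L"
  shows "Imp F H \<in> \<Pi> M L"
  using assms provable_formulas[OF assms(1)] provable_formulas[OF assms(2)]
  by (intro provable_taut[of "[Imp F G, Imp G H]"]) auto

text \<open>The quantifier moves inward past one premise at a time by \<open>all_imp\<close>, whose
  side condition holds because the premises are closed.\<close>

lemma provable_gen_Imps: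
  assumes "Imps \<phi>s F \<in> \<Pi> M L" and "\<forall>\<phi>\<in>set \<phi>s. free \<phi> = {}"
  shows "Imps \<phi>s (Qu Forall x F) \<in> \<Pi> M L"
proof -
  have "Imp (Qu Forall x (Imps \<phi>s F)) (Imps \<phi>s (Qu Forall x F)) \<in> \<Pi> M L"
    if "Imps \<phi>s F \<in> formulas M L"
    using that assms(2)
  proof (induction \<phi>s)
    case Nil
    then show ?case by (intro provable_taut[of "[]"]) auto
  next
    case (Cons \<phi> \<phi>s)
    \<comment> \<open>\<open>?A\<close> passes the first premise; \<open>?B\<close>, from the
      induction hypothesis, passes the others.\<close>
    let ?A = "Imp (Qu Forall x (Imp \<phi> (Imps \<phi>s F))) (Imp \<phi> (Qu Forall x (Imps \<phi>s F)))"
    let ?B = "Imp (Qu Forall x (Imps \<phi>s F)) (Imps \<phi>s (Qu Forall x F))"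
    have "?A \<in> \<Pi> M L"
      using Cons.prems by (intro provable_axiom) (auto intro: all_imp)
    moreover have "?B \<in> \<Pi> M L"
      using Cons by simp
    ultimately show ?case
      using Cons.prems by (intro provable_taut[of "[?A, ?B]"]) (auto simp: formulas_Imps)
  qed
  then show ?thesis
    using assms(1) provable_gen provable_mp provable_formulas by blast
qed

lemma provable_weaken:
  assumes "Imps \<phi>s F \<in> \<Pi> M L" and "set \<phi>s \<subseteq> set \<psi>s" and "set \<psi>s \<subseteq> formulas M L"
  shows "Imps \<psi>s F \<in> \<Pi> M L"
  using assms provable_formulas[OF assms(1)]
  by (intro provable_taut[of "[Imps \<phi>s F]"]) (auto simp: formulas_Imps fmval_Imps)

text \<open>Concatenating the individual premise lists gives a common one. The induction rule needs
  this, since its finitely many premises may come with different lists.\<close>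

lemma provable_weaken_finite:
  assumes "finite X" and "\<forall>F\<in>X. \<exists>\<phi>s. set \<phi>s \<subseteq> \<Phi> \<and> Imps \<phi>s F \<in> \<Pi> M L"
    and "\<Phi> \<subseteq> formulas M L"
  shows "\<exists>\<phi>s. set \<phi>s \<subseteq> \<Phi> \<and> (\<forall>F\<in>X. Imps \<phi>s F \<in> \<Pi> M L)"
  using assms(1,2)
proof (induction X)
  case empty
  then show ?case by (auto intro: exI[of _ "[]"])
next
  case (insert F X)
  then obtain \<phi>s \<psi>s where
    \<phi>s: "set \<phi>s \<subseteq> \<Phi>" "Imps \<phi>s F \<in> \<Pi> M L" and
    \<psi>s: "set \<psi>s \<subseteq> \<Phi>" "\<forall>F\<in>X. Imps \<psi>s F \<in> \<Pi> M L"
    by auto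
  have "\<forall>G\<in>insert F X. Imps (\<phi>s @ \<psi>s) G \<in> \<Pi> M L"
  proof
    have fms: "set (\<phi>s @ \<psi>s) \<subseteq> formulas M L"
      using \<phi>s(1) \<psi>s(1) assms(3) by auto
    fix G
    assume "G \<in> insert F X"
    then show "Imps (\<phi>s @ \<psi>s) G \<in> \<Pi> M L"
      using \<phi>s(2) \<psi>s(2) provable_weaken[OF _ _ fms, of \<phi>s] provable_weaken[OF _ _ fms, of \<psi>s]
      by auto
  qed
  then show ?case
    using \<phi>s(1) \<psi>s(1) by (intro exI[of _ "\<phi>s @ \<psi>s"]) auto
qed

section \<open>Renaming bound variables\<close>

lemma provable_all_mono:
  assumes "Imp F G \<in> \<Pi> M L"
  shows "Imp (Qu Forall x F) (Qu Forall x G) \<in> \<Pi> M L"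
  using assms provable_formulas[OF assms]
  by (intro provable_gen_imp provable_imp_trans[OF provable_all_elim]) auto

text \<open>Each direction instantiates one universal formula with the variable of the other and
  generalizes. The conditions on \<open>z\<close> and \<open>y\<close> exclude capture on the way
  there and on the way back.\<close>

lemma provable_all_rename:
  assumes F: "F \<in> formulas M L" and z: "z \<notin> var_fm F" "z \<noteq> y" and y: "y \<notin> bound F"
  shows "Bin Iff (Qu Forall y F) (Qu Forall z (SbF F [Var z] y)) \<in> \<Pi> M L"
proof -
  let ?F = "SbF F [Var z] y"
  have F': "?F \<in> formulas M L"
    using F by (simp add: SbF_formulas Var_in_L)
  have y_free: "y \<notin> free ?F"
    using free_SbF[of F "[Var z]" y] z by auto
  \<comment> \<open>The antecedent binds \<open>y\<close>, so the substitution only affects the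
    consequent.\<close>
  have "SbF (Imp (Qu Forall y F) F) [Var z] y \<in> \<Pi> M L"
    using F z
    by (intro provable_subst provable_all_elim Var_in_L) (auto simp: var_fm_eq intro: CF_bound)
  then have 1: "Imp (Qu Forall y F) (Qu Forall z ?F) \<in> \<Pi> M L"
    using z by (intro provable_gen_imp) (auto simp: var_fm_eq)
  have "SbF (Imp (Qu Forall z ?F) ?F) [Var y] z \<in> \<Pi> M L"
    using F' y
    by (intro provable_subst provable_all_elim Var_in_L) (auto intro: CF_bound)
  then have 2: "Imp (Qu Forall z ?F) (Qu Forall y F) \<in> \<Pi> M L"
    using y_free z by (intro provable_gen_imp) (auto simp: SbF_back)
  show ?thesis
    using F F' 1 2
    by (intro provable_taut
          [of "[Imp (Qu Forall y F) (Qu Forall z ?F), Imp (Qu Forall z ?F) (Qu Forall y F)]"]) auto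
qed

lemma provable_all_variant:
  assumes FG: "Bin Iff F G \<in> \<Pi> M L" and z: "z \<notin> var_fm G" "z \<noteq> y" and y: "y \<notin> bound G"
  shows "Bin Iff (Qu Forall y F) (Qu Forall z (SbF G [Var z] y)) \<in> \<Pi> M L"
proof -
  have fms: "F \<in> formulas M L" "G \<in> formulas M L" "SbF G [Var z] y \<in> formulas M L"
    using provable_formulas[OF FG] by (auto simp: SbF_formulas Var_in_L)
  have "Imp F G \<in> \<Pi> M L"
    by (rule provable_taut[of "[Bin Iff F G]"]) (use FG fms in auto)
  moreover have "Imp G F \<in> \<Pi> M L"
    by (rule provable_taut[of "[Bin Iff F G]"]) (use FG fms in auto)
  ultimately have "set [Imp (Qu Forall y F) (Qu Forall y G), Imp (Qu Forall y G) (Qu Forall y F),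
      Bin Iff (Qu Forall y G) (Qu Forall z (SbF G [Var z] y))] \<subseteq> \<Pi> M L"
    using fms z y by (simp add: provable_all_mono provable_all_rename)
  then show ?thesis
    by (rule provable_taut) (use fms in auto)
qed

text \<open>By \<open>ex_def\<close> the existential case reduces to the universal one for the
  negated formulas.\<close>

lemma provable_ex_variant:
  assumes FG: "Bin Iff F G \<in> \<Pi> M L" and z: "z \<notin> var_fm G" "z \<noteq> y" and y: "y \<notin> bound G"
  shows "Bin Iff (Qu Exists y F) (Qu Exists z (SbF G [Var z] y)) \<in> \<Pi> M L"
proof -
  let ?G = "SbF G [Var z] y"
  have fms: "F \<in> formulas M L" "G \<in> formulas M L" "?G \<in> formulas M L"
    using provable_formulas[OF FG] by (auto simp: SbF_formulas Var_in_L)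
  have "Bin Iff (Neg F) (Neg G) \<in> \<Pi> M L"
    by (rule provable_taut[of "[Bin Iff F G]"]) (use FG fms in auto)
  from provable_all_variant[OF this, of z y]
  have "Bin Iff (Qu Forall y (Neg F)) (Qu Forall z (Neg ?G)) \<in> \<Pi> M L"
    using z y by simp
  moreover have "Bin Iff (Neg (Qu Forall x (Neg H))) (Qu Exists x H) \<in> \<Pi> M L"
    if "H \<in> formulas M L" for x H
    using that by (intro provable_axiom) (auto intro: ex_def)
  ultimately have "set [Bin Iff (Qu Forall y (Neg F)) (Qu Forall z (Neg ?G)),
      Bin Iff (Neg (Qu Forall y (Neg F))) (Qu Exists y F),
      Bin Iff (Neg (Qu Forall z (Neg ?G))) (Qu Exists z ?G)] \<subseteq> \<Pi> M L"
    using fms by simp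
  then show ?thesis
    by (rule provable_taut) (use fms in auto)
qed

text \<open>Structural induction with arbitrary \<open>V\<close>, so that the quantifier case may
  enlarge the set to be avoided. The inclusion of free variables keeps variants of statements
  closed.\<close>

lemma alphabetic_variant:
  assumes "F \<in> formulas M L" and "finite V"
  shows "\<exists>G. bound G \<inter> V = {} \<and> free G \<subseteq> free F \<and> Bin Iff F G \<in> \<Pi> M L"
  using assms
proof (induction F arbitrary: V)
  case (Eq l m)
  then show ?case
    by (intro exI[of _ "Eq l m"]) (auto intro: provable_taut[of "[]"])
next
  case (Pred p ls)
  then show ?case
    by (intro exI[of _ "Pred p ls"]) (auto intro: provable_taut[of "[]"])
next
  case (Neg F)
  then obtain G where G: "bound G \<inter> V = {}" "free G \<subseteq> free F" "Bin Iff F G \<in> \<Pi> M L"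
    by (metis formulas_Neg)
  then have "Bin Iff (Neg F) (Neg G) \<in> \<Pi> M L"
    using provable_formulas[OF G(3)] by (intro provable_taut[of "[Bin Iff F G]"]) auto
  with G show ?case by (intro exI[of _ "Neg G"]) auto
next
  case (Bin J F1 F2)
  then obtain G1 G2 where G:
    "bound G1 \<inter> V = {}" "free G1 \<subseteq> free F1" "Bin Iff F1 G1 \<in> \<Pi> M L"
    "bound G2 \<inter> V = {}" "free G2 \<subseteq> free F2" "Bin Iff F2 G2 \<in> \<Pi> M L"
    by (metis formulas_Bin)
  then have "Bin Iff (Bin J F1 F2) (Bin J G1 G2) \<in> \<Pi> M L"
    using provable_formulas[OF G(3)] provable_formulas[OF G(6)]
    by (intro provable_taut[of "[Bin Iff F1 G1, Bin Iff F2 G2]"]) auto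
  with G show ?case by (intro exI[of _ "Bin J G1 G2"]) auto
next
  case (Qu Q y F)
  \<comment> \<open>Avoiding \<open>y\<close> as well secures the condition
    \<open>y \<notin> bound G\<close> of the renaming lemmas.\<close>
  then obtain G where
    G: "bound G \<inter> insert y V = {}" "free G \<subseteq> free F" "Bin Iff F G \<in> \<Pi> M L"
    by (metis formulas_Qu finite_insert)
  obtain z where "z \<notin> insert y V \<union> var_fm G"
    using ex_new_if_finite[of "insert y V \<union> var_fm G"] Qu.prems(2)
    by (auto simp: finite_var_fm)
  then have z: "z \<notin> var_fm G" "z \<noteq> y" "z \<notin> V" by auto
  let ?H = "Qu Q z (SbF G [Var z] y)"
  have "Bin Iff (Qu Q y F) ?H \<in> \<Pi> M L"
    using provable_all_variant[OF G(3) z(1,2)] provable_ex_variant[OF G(3) z(1,2)] G(1)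
    by (cases Q) auto
  moreover have "bound ?H \<inter> V = {}"
    using G(1) z(3) by auto
  moreover have "free ?H \<subseteq> free (Qu Q y F)"
    using free_SbF[of G "[Var z]" y] G(2) by auto
  ultimately show ?case by blast
qed

section \<open>The deduction theorem\<close>

lemma induction_from_premises:
  assumes p: "p \<in> PS (RS M)" and xs: "distinct xs" "set xs \<inter> var_BS (RS M) = {}"
    and G: "G \<in> formulas M L" "var_fm G \<inter> var_BS (RS M) = {}"
    and \<phi>s: "set \<phi>s \<subseteq> statements M L"
    and basis: "\<And>F ls. F \<in> set (BS (RS M)) \<Longrightarrow> R_concl F (Pred p ls) \<Longrightarrow>
      length ls = length xs \<Longrightarrow> Imps \<phi>s (repl p xs G F) \<in> \<Pi> M L"
  shows "Imps \<phi>s (Imp (Pred p (map (\<lambda>x. [Var x]) xs)) G) \<in> \<Pi> M L"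
proof -
  have "\<forall>\<phi>\<in>set \<phi>s. \<exists>\<psi>. bound \<psi> \<inter> var_BS (RS M) = {} \<and> free \<psi> \<subseteq> free \<phi> \<and> Bin Iff \<phi> \<psi> \<in> \<Pi> M L"
    using \<phi>s by (auto simp: statements_def intro: alphabetic_variant finite_var_BS)
  then obtain r where r: "\<forall>\<phi>\<in>set \<phi>s. bound (r \<phi>) \<inter> var_BS (RS M) = {} \<and>
      free (r \<phi>) \<subseteq> free \<phi> \<and> Bin Iff \<phi> (r \<phi>) \<in> \<Pi> M L"
    by metis
  let ?iffs = "map (\<lambda>\<phi>. Bin Iff \<phi> (r \<phi>)) \<phi>s"
  \<comment> \<open>The renamed premises are put into the induction formula itself, since the rule
    has no place for side premises.\<close>
  let ?G = "Imps (map r \<phi>s) G"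
  let ?P = "Pred p (map (\<lambda>x. [Var x]) xs)"
  have iffs: "set ?iffs \<subseteq> \<Pi> M L"
    using r by auto
  have closed: "\<forall>\<psi>\<in>set (map r \<phi>s). free \<psi> = {}"
    using r \<phi>s by (fastforce simp: statements_def)
  have \<phi>s_fm: "set \<phi>s \<subseteq> formulas M L"
    using \<phi>s by (auto simp: statements_def)
  have G': "?G \<in> formulas M L"
    using r G(1) by (auto simp: formulas_Imps dest!: provable_formulas)
  have "Imp ?P ?G \<in> \<Pi> M L"
  proof (rule provable_induction[OF p xs(1) G' xs(2)])
    \<comment> \<open>The formulas \<open>r \<phi>\<close> are closed, so all their variables are
      bound, and these were renamed away from the basis.\<close>
    show "var_fm ?G \<inter> var_BS (RS M) = {}"
      using G(2) closed r by (auto simp: var_fm_Imps var_fm_eq[of "r _"])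
  next
    fix F ls
    assume F: "F \<in> set (BS (RS M))" "R_concl F (Pred p ls)" and ls: "length ls = length xs"
    then obtain Fs where Fs: "set Fs \<subseteq> prime_over UNIV UNIV" "F = Imps Fs (Pred p ls)"
      by (auto simp: R_concl_def)
    \<comment> \<open>The R-premises in \<open>Fs\<close> may also contain \<open>p\<close>, so the
      replacement changes them too.\<close>
    have rp: "fmval v (repl p xs ?G H) \<longleftrightarrow> fmval v (repl p xs G H)"
      if "\<forall>\<psi>\<in>set (map r \<phi>s). fmval v \<psi>" "H \<in> set Fs" for v H
      using that Fs(1) by (intro repl_prime[OF closed]) auto
    show "repl p xs ?G F \<in> \<Pi> M L"
    proof (rule provable_taut)
      show "set (Imps \<phi>s (repl p xs G F) # ?iffs) \<subseteq> \<Pi> M L"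
        using basis[OF F ls] iffs by simp
      show "repl p xs ?G F \<in> formulas M L"
        using F(1) BS_formulas G' by (auto intro: repl_formulas)
    next
      fix v
      assume v: "\<forall>H\<in>set (Imps \<phi>s (repl p xs G F) # ?iffs). fmval v H"
      then have eqv: "\<forall>\<phi>\<in>set \<phi>s. fmval v \<phi> \<longleftrightarrow> fmval v (r \<phi>)"
        by auto
      have imp: "fmval v (Imps \<phi>s (repl p xs G F))"
        using v by simp
      show "fmval v (repl p xs ?G F)"
      \<comment> \<open>If the renamed premises hold, replacing by \<open>?G\<close> or by
        \<open>G\<close> gives the same truth values. Otherwise the replaced R-conclusion is an
        implication with a false premise, hence true.\<close>
      proof (cases "\<forall>\<psi>\<in>set (map r \<phi>s). fmval v \<psi>")
        case True
        then have "fmval v (repl p xs G F)"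
          using imp eqv by (auto simp: fmval_Imps)
        then show ?thesis
          using rp[OF True] closed ls
          by (auto simp: Fs(2) repl_Imps fmval_Imps SbFs_Imps_closed)
      next
        case False
        then show ?thesis
          using closed ls by (auto simp: Fs(2) repl_Imps fmval_Imps SbFs_Imps_closed)
      qed
    qed
  qed
  \<comment> \<open>Propositionally, the equivalences turn the renamed premises back into
    \<open>\<phi>s\<close>, which then move in front of \<open>?P\<close>.\<close>
  then show ?thesis
    using iffs G(1) \<phi>s_fm p
    by (intro provable_taut[of "Imp ?P ?G # ?iffs"])
      (auto simp: formulas_Imps fmval_Imps Pred_Var_formulas)
qed

lemma deduction:
  assumes \<Phi>: "\<Phi> \<subseteq> statements M L" and "is_proof (adjoin M \<Phi>) L \<Lambda>"
  shows "\<forall>F\<in>set \<Lambda>. \<exists>\<phi>s. set \<phi>s \<subseteq> \<Phi> \<and> Imps \<phi>s F \<in> \<Pi> M L"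
  using assms(2)
proof (induction rule: is_proof.induct)
  case empty
  then show ?case by simp
next
  case (axiom \<Lambda> F)
  have "\<exists>\<phi>s. set \<phi>s \<subseteq> \<Phi> \<and> Imps \<phi>s F \<in> \<Pi> M L"
  proof (cases "F \<in> \<Phi>")
    case True
    then show ?thesis
      using axiom by (intro exI[of _ "[F]"]) (auto intro: provable_taut[of "[]"])
  next
    case False
    then show ?thesis
      using axiom by (intro exI[of _ "[]"]) (auto intro: provable_axiom)
  qed
  with axiom.IH show ?case by simp
next
  case (mp \<Lambda> F G)
  then obtain \<phi>s \<psi>s where
    "set \<phi>s \<subseteq> \<Phi>" and F: "Imps \<phi>s F \<in> \<Pi> M L" and
    "set \<psi>s \<subseteq> \<Phi>" and FG: "Imps \<psi>s (Imp F G) \<in> \<Pi> M L"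
    by blast
  moreover have "Imps (\<phi>s @ \<psi>s) G \<in> \<Pi> M L"
    using F FG provable_formulas[OF F] provable_formulas[OF FG]
    by (intro provable_taut[of "[Imps \<phi>s F, Imps \<psi>s (Imp F G)]"])
      (auto simp: formulas_Imps fmval_Imps)
  ultimately have "\<exists>\<phi>s. set \<phi>s \<subseteq> \<Phi> \<and> Imps \<phi>s G \<in> \<Pi> M L"
    by (intro exI[of _ "\<phi>s @ \<psi>s"]) auto
  with mp.IH show ?case by simp
next
  case (subst \<Lambda> F l x)
  then obtain \<phi>s where \<phi>s: "set \<phi>s \<subseteq> \<Phi>" "Imps \<phi>s F \<in> \<Pi> M L"
    by blast
  then have closed: "\<forall>\<phi>\<in>set \<phi>s. free \<phi> = {}"
    using \<Phi> by (auto simp: statements_def)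
  \<comment> \<open>The premises admit every substitution, so \<open>CF\<close> for \<open>F\<close>
    alone permits this one.\<close>
  have "SbF (Imps \<phi>s F) l x \<in> \<Pi> M L"
    using subst \<phi>s(2) closed by (intro provable_subst) (auto simp: CF_Imps CF_notin)
  then show ?case
    using subst.IH \<phi>s(1) closed by (auto simp: SbF_Imps_closed)
next
  case (gen \<Lambda> F x)
  then obtain \<phi>s where \<phi>s: "set \<phi>s \<subseteq> \<Phi>" "Imps \<phi>s F \<in> \<Pi> M L"
    by blast
  then have "Imps \<phi>s (Qu Forall x F) \<in> \<Pi> M L"
    using \<Phi> by (intro provable_gen_Imps) (auto simp: statements_def)
  with gen.IH \<phi>s(1) show ?case by auto
next
  case (induction \<Lambda> p xs G)
  \<comment> \<open>The basis is that of \<open>RS M\<close>, to which the statements in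
    \<open>\<Phi>\<close> are not added.\<close>
  let ?X = "repl p xs G ` {F \<in> set (BS (RS M)). \<exists>ls. R_concl F (Pred p ls) \<and> length ls = length xs}"
  have "\<exists>\<phi>s. set \<phi>s \<subseteq> \<Phi> \<and> (\<forall>F\<in>?X. Imps \<phi>s F \<in> \<Pi> M L)"
  proof (rule provable_weaken_finite)
    show "\<forall>F\<in>?X. \<exists>\<phi>s. set \<phi>s \<subseteq> \<Phi> \<and> Imps \<phi>s F \<in> \<Pi> M L"
      using induction by auto
  qed (use \<Phi> in \<open>auto simp: statements_def\<close>)
  then obtain \<phi>s where \<phi>s: "set \<phi>s \<subseteq> \<Phi>" "\<forall>F\<in>?X. Imps \<phi>s F \<in> \<Pi> M L"
    by blast
  have "Imps \<phi>s (Imp (Pred p (map (\<lambda>x. [Var x]) xs)) G) \<in> \<Pi> M L"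
    by (rule induction_from_premises) (use induction \<phi>s \<Phi> in auto)
  with induction.IH \<phi>s(1) show ?case by auto
qed

end

theorem mainTheorem13:
  fixes M :: "('a, 'p) math_sys"
    and L :: "'a lst set"
    and \<Phi> :: "('a, 'p) fm set"
    and F :: "('a, 'p) fm"
  assumes "restricted_system M L"
    and "\<Phi> \<subseteq> statements M L"
    and "F \<in> formulas M L"
  shows "F \<in> \<Pi> (adjoin M \<Phi>) L \<longleftrightarrow>
    (\<exists>\<phi>s. set \<phi>s \<subseteq> \<Phi> \<and> Imps \<phi>s F \<in> \<Pi> M L)"
proof
  assume "F \<in> \<Pi> (adjoin M \<Phi>) L"
  then show "\<exists>\<phi>s. set \<phi>s \<subseteq> \<Phi> \<and> Imps \<phi>s F \<in> \<Pi> M L"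
    using deduction[OF assms(1,2)] by (auto simp: provable_def[of "adjoin M \<Phi>"])
next
  assume "\<exists>\<phi>s. set \<phi>s \<subseteq> \<Phi> \<and> Imps \<phi>s F \<in> \<Pi> M L"
  then obtain \<phi>s where \<phi>s: "set \<phi>s \<subseteq> \<Phi>" "Imps \<phi>s F \<in> \<Pi> M L"
    by blast
  \<comment> \<open>Each premise is an axiom of the enlarged system, so modus ponens can discharge
    it.\<close>
  have "set \<phi>s \<subseteq> \<Pi> (adjoin M \<Phi>) L"
    using \<phi>s(1) assms(2) by (auto simp: statements_def intro!: provable_axiom)
  then show "F \<in> \<Pi> (adjoin M \<Phi>) L"
    using provable_Imps_mp[OF provable_adjoin[OF \<phi>s(2)]] by blast
qed

end
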